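(* Let $u,v\in\mathrm{Iso}_2$ and $u\sim v$. If $u\in C^1_b(\mathbb{R}^d,L^2(\Omega))$ then for every $z\in\mathbb{R}^d\setminus\{0\}$ (and every $x\in\mathbb{R}^d$) we have $$E\,\nabla_{\!z}u(x)\,v(x)=0.$$
   Context: Fix a probability space $(\Omega,\Sigma,P)$ with expectation $E$; $L^2(\Omega)$ consists of real random variables. $C_b(\mathbb{R}^d,L^2(\Omega))$ is the space of bounded continuous maps $u:\mathbb{R}^d\to L^2(\Omega)$ with norm $\|u\|_2=\sup_x\|u(x)\|_{L^2(\Omega)}$. For random fields (scalar or vector valued), $\overset{d}{=}$ denotes equality of all finite-dimensional distributions. $\Phi$ is the group of isometries of $\mathbb{R}^d$, and $(\phi u)(x)=u(\phi(x))$. $\mathrm{Iso}_2=\{u\in C_b(\mathbb{R}^d,L^2(\Omega)): u\overset{d}{=}\phi u\text{ for every }\phi\in\Phi\}$. For $u,v\in\mathrm{Iso}_2$, $u\sim v$ means that $(u,v)\overset{d}{=}(\phi u,\phi v)$ for every $\phi\in\Phi$. The (normalised) directional derivative $\nabla_{\!z}u$ is the random field such that $\lim_{h\to0}\big\|\frac{u(x+hz)-u(x)}{h|z|}-\nabla_{\!z}u(x)\big\|_2=0$ whenever the limit exists. $u\in C^1_b(\mathbb{R}^d,L^2(\Omega))$ means that $\nabla_{\!z}u\in C_b(\mathbb{R}^d,L^2(\Omega))$ for every such $z$. *)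

theory Defs
  imports "HOL-Probability.Probability"
begin

text \<open>
  Elements of \<open>L\<^sup>2(\<Omega>)\<close> are given by square-integrable representatives rather than by classes
  modulo almost sure equality. All notions below are invariant under changing a field \<open>u\<close> to
  another field \<open>u'\<close> with \<open>u x = u' x\<close> almost surely for every \<open>x\<close>.
\<close>

definition L2 :: "'w measure \<Rightarrow> ('w \<Rightarrow> real) set" where
  "L2 M = {X. X \<in> borel_measurable M \<and> integrable M (\<lambda>\<omega>. (X \<omega>)\<^sup>2)}"

definition L2_norm :: "'w measure \<Rightarrow> ('w \<Rightarrow> real) \<Rightarrow> real" where
  "L2_norm M X = sqrt (\<integral>\<omega>. (X \<omega>)\<^sup>2 \<partial>M)"

lemma L2_mult_integrable:
  assumes "X \<in> L2 M" "Y \<in> L2 M"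
  shows "integrable M (\<lambda>\<omega>. X \<omega> * Y \<omega>)"
proof (rule Bochner_Integration.integrable_bound)
  show "integrable M (\<lambda>\<omega>. (X \<omega>)\<^sup>2 + (Y \<omega>)\<^sup>2)"
    using assms by (simp add: L2_def)
  show "(\<lambda>\<omega>. X \<omega> * Y \<omega>) \<in> borel_measurable M"
    using assms by (auto simp: L2_def)
  have "\<bar>a * b\<bar> \<le> a\<^sup>2 + b\<^sup>2" for a b :: real
  proof -
    have "2 * (\<bar>a\<bar> * \<bar>b\<bar>) \<le> a\<^sup>2 + b\<^sup>2"
      using sum_squares_bound[of "\<bar>a\<bar>" "\<bar>b\<bar>"] by (simp add: mult.assoc)
    moreover have "0 \<le> \<bar>a\<bar> * \<bar>b\<bar>" by simp
    ultimately show ?thesis unfolding abs_mult by linarith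
  qed
  then show "AE \<omega> in M. norm (X \<omega> * Y \<omega>) \<le> norm ((X \<omega>)\<^sup>2 + (Y \<omega>)\<^sup>2)"
    by simp
qed

text \<open>
  The supremum norm takes values in \<^typ>\<open>ennreal\<close>, so that it is meaningful (namely \<open>\<infinity>\<close>) for
  unbounded fields.
\<close>

definition field_norm :: "'w measure \<Rightarrow> ('a \<Rightarrow> 'w \<Rightarrow> real) \<Rightarrow> ennreal" where
  "field_norm M u = (SUP x. ennreal (L2_norm M (u x)))"

definition Cb :: "'w measure \<Rightarrow> ('a::euclidean_space \<Rightarrow> 'w \<Rightarrow> real) set" where
  "Cb M = {u. (\<forall>x. u x \<in> L2 M) \<and> field_norm M u < \<infinity> \<and>
     (\<forall>x. ((\<lambda>y. L2_norm M (\<lambda>\<omega>. u y \<omega> - u x \<omega>)) \<longlongrightarrow> 0) (at x))}"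

definition eq_fdd ::
  "'w measure \<Rightarrow> ('a \<Rightarrow> 'w \<Rightarrow> 'b::topological_space) \<Rightarrow> ('a \<Rightarrow> 'w \<Rightarrow> 'b) \<Rightarrow> bool" where
  "eq_fdd M U V \<longleftrightarrow> (\<forall>J. finite J \<longrightarrow>
     distr M (PiM J (\<lambda>_. borel)) (\<lambda>\<omega>. \<lambda>x\<in>J. U x \<omega>) =
     distr M (PiM J (\<lambda>_. borel)) (\<lambda>\<omega>. \<lambda>x\<in>J. V x \<omega>))"

definition isometries :: "('a::metric_space \<Rightarrow> 'a) set" where
  "isometries = {\<phi>. bij \<phi> \<and> (\<forall>x y. dist (\<phi> x) (\<phi> y) = dist x y)}"

definition Iso2 :: "'w measure \<Rightarrow> ('a::euclidean_space \<Rightarrow> 'w \<Rightarrow> real) set" where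
  "Iso2 M = {u \<in> Cb M. \<forall>\<phi>\<in>isometries. eq_fdd M u (\<lambda>x. u (\<phi> x))}"

definition jointly_isotropic ::
  "'w measure \<Rightarrow> ('a::euclidean_space \<Rightarrow> 'w \<Rightarrow> real) \<Rightarrow> ('a \<Rightarrow> 'w \<Rightarrow> real) \<Rightarrow> bool" where
  "jointly_isotropic M u v \<longleftrightarrow> (\<forall>\<phi>\<in>isometries.
     eq_fdd M (\<lambda>x \<omega>. (u x \<omega>, v x \<omega>)) (\<lambda>x \<omega>. (u (\<phi> x) \<omega>, v (\<phi> x) \<omega>)))"

text \<open>
  The directional derivative is determined only up to almost sure equality at each point, so
  it is a relation: \<open>has_dir_deriv M u z w\<close> says that \<open>w\<close> is a version of \<open>\<nabla>\<^sub>z u\<close>. The limit is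
  taken in the supremum norm, i.e. uniformly in \<open>x\<close>.
\<close>

definition has_dir_deriv ::
  "'w measure \<Rightarrow> ('a::euclidean_space \<Rightarrow> 'w \<Rightarrow> real) \<Rightarrow> 'a \<Rightarrow> ('a \<Rightarrow> 'w \<Rightarrow> real) \<Rightarrow> bool" where
  "has_dir_deriv M u z w \<longleftrightarrow> (\<forall>x. w x \<in> L2 M) \<and>
     ((\<lambda>h::real. field_norm M
        (\<lambda>x \<omega>. (u (x + h *\<^sub>R z) \<omega> - u x \<omega>) / (h * norm z) - w x \<omega>)) \<longlongrightarrow> 0) (at 0)"

definition Cb1 :: "'w measure \<Rightarrow> ('a::euclidean_space \<Rightarrow> 'w \<Rightarrow> real) set" where
  "Cb1 M = {u \<in> Cb M. \<forall>z. z \<noteq> 0 \<longrightarrow> (\<exists>w\<in>Cb M. has_dir_deriv M u z w)}"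

end

theory Submission
  imports Defs
begin

text \<open>
  Fix \<open>x\<close> and \<open>z\<close>. The reflection \<open>y \<mapsto> 2 x - y\<close> is an isometry that fixes \<open>x\<close> and exchanges
  \<open>x + h z\<close> and \<open>x - h z\<close>. Joint isotropy is equality of joint laws, so it preserves correlations
  (\<open>jointly_isotropic_correlation\<close>), and therefore \<open>h \<mapsto> E (u (x + h z) v x)\<close> is even. An even
  function that is differentiable at \<open>0\<close> has derivative \<open>0\<close> there. The derivative is
  \<open>|z| E (\<nabla>\<^sub>z u x v x)\<close>, because by Cauchy-Schwarz the \<open>L\<^sup>2\<close> limit of the difference quotients may
  be taken inside the expectation (\<open>has_dir_deriv_pairing_tendsto\<close>).
\<close>

lemma L2_diff:
  assumes X: "X \<in> L2 M" and Y: "Y \<in> L2 M"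
  shows "(\<lambda>\<omega>. X \<omega> - Y \<omega>) \<in> L2 M"
proof -
  have "integrable M (\<lambda>\<omega>. (X \<omega>)\<^sup>2 + (Y \<omega>)\<^sup>2 - 2 * (X \<omega> * Y \<omega>))"
    using L2_mult_integrable[OF X Y] X Y by (simp add: L2_def)
  then show ?thesis
    using X Y by (auto simp: L2_def power2_diff mult.assoc)
qed

lemma L2_divide_const:
  assumes "X \<in> L2 M"
  shows "(\<lambda>\<omega>. X \<omega> / c) \<in> L2 M"
  using assms by (auto simp: L2_def power_divide)

text \<open>
  The quadratic \<open>E (X - t Y)\<^sup>2 = E X\<^sup>2 - 2 t E (X Y) + t\<^sup>2 E Y\<^sup>2\<close> is nonnegative for every real \<open>t\<close>,
  so its discriminant is not positive.
\<close>

lemma L2_Cauchy_Schwarz: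
  assumes X: "X \<in> L2 M" and Y: "Y \<in> L2 M"
  shows "\<bar>\<integral>\<omega>. X \<omega> * Y \<omega> \<partial>M\<bar> \<le> L2_norm M X * L2_norm M Y"
proof -
  define a b c where "a = (\<integral>\<omega>. (X \<omega>)\<^sup>2 \<partial>M)" and "b = (\<integral>\<omega>. X \<omega> * Y \<omega> \<partial>M)"
    and "c = (\<integral>\<omega>. (Y \<omega>)\<^sup>2 \<partial>M)"
  have [simp]: "integrable M (\<lambda>\<omega>. (X \<omega>)\<^sup>2)" "integrable M (\<lambda>\<omega>. (Y \<omega>)\<^sup>2)"
    "integrable M (\<lambda>\<omega>. X \<omega> * Y \<omega>)"
    using X Y L2_mult_integrable[OF X Y] by (auto simp: L2_def)
  have nonneg: "0 \<le> a" "0 \<le> c"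
    unfolding a_def c_def by simp_all
  have quad: "0 \<le> a - 2 * t * b + t\<^sup>2 * c" for t :: real
  proof -
    have "0 \<le> (\<integral>\<omega>. (X \<omega> - t * Y \<omega>)\<^sup>2 \<partial>M)"
      by simp
    also have "\<dots> = (\<integral>\<omega>. (X \<omega>)\<^sup>2 - 2 * t * (X \<omega> * Y \<omega>) + t\<^sup>2 * (Y \<omega>)\<^sup>2 \<partial>M)"
      by (intro Bochner_Integration.integral_cong) (auto simp: power2_eq_square algebra_simps)
    also have "\<dots> = a - 2 * t * b + t\<^sup>2 * c"
      by (simp add: a_def b_def c_def)
    finally show ?thesis .
  qed
  have "b\<^sup>2 \<le> a * c"
  proof (cases "c = 0")
    case True
    \<comment> \<open>The quadratic degenerates to a line that stays nonnegative, so its slope vanishes.\<close>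
    have "b = 0"
    proof (rule ccontr)
      assume "b \<noteq> 0"
      then show False
        using quad[of "(a + 1) / (2 * b)"] True by simp
    qed
    then show ?thesis using True by simp
  next
    case False
    with nonneg have "c > 0" by simp
    then show ?thesis
      using quad[of "b / c"] by (simp add: field_simps power2_eq_square)
  qed
  then have "sqrt (b\<^sup>2) \<le> sqrt (a * c)"
    by (rule real_sqrt_le_mono)
  then show ?thesis
    by (simp add: real_sqrt_mult L2_norm_def a_def b_def c_def)
qed

text \<open>
  A correlation is an integral against the two-point joint distribution: it is the integral of
  \<open>f \<mapsto> fst (f a) * snd (f b)\<close> under the law of the pair field on \<open>{a, b}\<close>.
\<close>

lemma jointly_isotropic_correlation:
  assumes meas: "\<And>x. u x \<in> borel_measurable M" "\<And>x. v x \<in> borel_measurable M"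
    and iso: "jointly_isotropic M u v" and \<phi>: "\<phi> \<in> isometries"
  shows "(\<integral>\<omega>. u a \<omega> * v b \<omega> \<partial>M) = (\<integral>\<omega>. u (\<phi> a) \<omega> * v (\<phi> b) \<omega> \<partial>M)"
proof -
  define J where "J = {a, b}"
  define P where "P = PiM J (\<lambda>_. borel :: (real \<times> real) measure)"
  define g :: "('a \<Rightarrow> real \<times> real) \<Rightarrow> real" where "g = (\<lambda>f. fst (f a) * snd (f b))"
  define U where "U = (\<lambda>\<psi> \<omega>. \<lambda>x\<in>J. (u (\<psi> x) \<omega>, v (\<psi> x) \<omega>))"
  have [measurable]: "(\<lambda>f. f a) \<in> measurable P borel" "(\<lambda>f. f b) \<in> measurable P borel"
    unfolding P_def by (auto intro!: measurable_component_singleton simp: J_def)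
  have [measurable]: "(fst :: real \<times> real \<Rightarrow> real) \<in> borel_measurable borel"
      "(snd :: real \<times> real \<Rightarrow> real) \<in> borel_measurable borel"
    by (intro borel_measurable_continuous_onI continuous_intros)+
  have g: "g \<in> borel_measurable P"
    unfolding g_def by measurable
  have U: "U \<psi> \<in> measurable M P" for \<psi>
    unfolding U_def P_def
    by (intro measurable_restrict borel_measurable_Pair meas)
  have correlation: "(\<integral>f. g f \<partial>distr M P (U \<psi>)) = (\<integral>\<omega>. u (\<psi> a) \<omega> * v (\<psi> b) \<omega> \<partial>M)" for \<psi>
    by (subst integral_distr[OF U g]) (simp add: g_def U_def J_def)
  have "distr M P (U id) = distr M P (U \<phi>)"
    using iso \<phi> unfolding jointly_isotropic_def eq_fdd_def P_def U_def J_def by simp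
  then show ?thesis
    using correlation[of id] correlation[of \<phi>] by simp
qed

lemma point_reflection_isometry:
  "(\<lambda>y. 2 *\<^sub>R x - y) \<in> (isometries :: ('a::real_normed_vector \<Rightarrow> 'a) set)"
proof -
  have "bij (\<lambda>y. 2 *\<^sub>R x - y)"
    by (rule o_bij[where g = "\<lambda>y. 2 *\<^sub>R x - y"]) auto
  then show ?thesis
    by (auto simp: isometries_def dist_norm norm_minus_commute)
qed

text \<open>
  Being uniform in \<open>x\<close>, the limit that defines \<open>w\<close> holds in \<open>L\<^sup>2\<close> at each \<open>x\<close>, and pairing with a
  fixed \<open>L\<^sup>2\<close> variable is continuous there.
\<close>

lemma has_dir_deriv_pairing_tendsto:
  assumes u: "\<And>x. u x \<in> L2 M" and Y: "Y \<in> L2 M" and w: "has_dir_deriv M u z w"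
  shows "((\<lambda>h. \<integral>\<omega>. (u (x + h *\<^sub>R z) \<omega> - u x \<omega>) / (h * norm z) * Y \<omega> \<partial>M)
    \<longlongrightarrow> (\<integral>\<omega>. w x \<omega> * Y \<omega> \<partial>M)) (at 0)"
proof -
  define D where "D = (\<lambda>h x \<omega>. (u (x + h *\<^sub>R z) \<omega> - u x \<omega>) / (h * norm z))"
  have wL2: "w x \<in> L2 M"
    using w by (simp add: has_dir_deriv_def)
  have DL2: "D h x \<in> L2 M" for h
    unfolding D_def by (intro L2_divide_const L2_diff u)
  define N where "N = (\<lambda>h. L2_norm M (\<lambda>\<omega>. D h x \<omega> - w x \<omega>))"
  have "((\<lambda>h. ennreal (N h)) \<longlongrightarrow> ennreal 0) (at 0)"
  proof (rule tendsto_sandwich[where f = "\<lambda>_. 0"])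
    show "\<forall>\<^sub>F h in at 0. ennreal (N h) \<le> field_norm M (\<lambda>x \<omega>. D h x \<omega> - w x \<omega>)"
      unfolding field_norm_def N_def
      by (intro always_eventually allI SUP_upper2[of x]) auto
    show "((\<lambda>h. field_norm M (\<lambda>x \<omega>. D h x \<omega> - w x \<omega>)) \<longlongrightarrow> ennreal 0) (at 0)"
      using w by (simp add: has_dir_deriv_def D_def)
  qed (auto intro!: tendsto_const)
  moreover have "N h \<ge> 0" for h
    by (simp add: N_def L2_norm_def)
  ultimately have N: "(N \<longlongrightarrow> 0) (at 0)"
    by (subst (asm) tendsto_ennreal_iff) auto
  have "((\<lambda>h. (\<integral>\<omega>. D h x \<omega> * Y \<omega> \<partial>M) - (\<integral>\<omega>. w x \<omega> * Y \<omega> \<partial>M)) \<longlongrightarrow> 0) (at 0)"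
  proof (rule Lim_null_comparison)
    have "norm ((\<integral>\<omega>. D h x \<omega> * Y \<omega> \<partial>M) - (\<integral>\<omega>. w x \<omega> * Y \<omega> \<partial>M)) \<le> N h * L2_norm M Y" for h
      using L2_Cauchy_Schwarz[OF L2_diff[OF DL2 wL2] Y, of h]
      by (simp add: N_def left_diff_distrib L2_mult_integrable[OF DL2 Y] L2_mult_integrable[OF wL2 Y])
    then show "\<forall>\<^sub>F h in at 0. norm ((\<integral>\<omega>. D h x \<omega> * Y \<omega> \<partial>M) - (\<integral>\<omega>. w x \<omega> * Y \<omega> \<partial>M))
        \<le> N h * L2_norm M Y"
      by simp
    show "((\<lambda>h. N h * L2_norm M Y) \<longlongrightarrow> 0) (at 0)"
      by (intro tendsto_mult_left_zero N)
  qed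
  then show ?thesis
    unfolding D_def by (rule LIM_zero_cancel)
qed

theorem lemma2p11:
  fixes M :: "'w measure" and u v :: "real ^ 'd \<Rightarrow> 'w \<Rightarrow> real"
  assumes "prob_space M"
    and "u \<in> Iso2 M" and "v \<in> Iso2 M"
    and "jointly_isotropic M u v"
    and "u \<in> Cb1 M"
  shows "\<forall>z w x. z \<noteq> 0 \<longrightarrow> has_dir_deriv M u z w \<longrightarrow> (\<integral>\<omega>. w x \<omega> * v x \<omega> \<partial>M) = 0"
proof (intro allI impI)
  fix z :: "real ^ 'd" and w :: "real ^ 'd \<Rightarrow> 'w \<Rightarrow> real" and x :: "real ^ 'd"
  assume w: "has_dir_deriv M u z w"
  have L2: "u y \<in> L2 M" "v y \<in> L2 M" for y
    using assms by (auto simp: Iso2_def Cb_def)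
  then have meas: "u y \<in> borel_measurable M" "v y \<in> borel_measurable M" for y
    by (auto simp: L2_def)
  define L where "L = (\<integral>\<omega>. w x \<omega> * v x \<omega> \<partial>M)"
  define q where "q = (\<lambda>h. \<integral>\<omega>. (u (x + h *\<^sub>R z) \<omega> - u x \<omega>) / (h * norm z) * v x \<omega> \<partial>M)"
  have q_eq: "q h = ((\<integral>\<omega>. u (x + h *\<^sub>R z) \<omega> * v x \<omega> \<partial>M) - (\<integral>\<omega>. u x \<omega> * v x \<omega> \<partial>M))
      / (h * norm z)" for h
    unfolding q_def by (simp add: left_diff_distrib L2_mult_integrable L2)
  have odd: "q (- h) = - q h" for h
  proof -
    have "(\<integral>\<omega>. u (x + h *\<^sub>R z) \<omega> * v x \<omega> \<partial>M) = (\<integral>\<omega>. u (x + (- h) *\<^sub>R z) \<omega> * v x \<omega> \<partial>M)"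
      using jointly_isotropic_correlation[OF meas assms(4) point_reflection_isometry[of x],
          of "x + h *\<^sub>R z" x]
      by (simp add: scaleR_2 algebra_simps)
    then show ?thesis
      by (simp add: q_eq)
  qed
  have lim: "(q \<longlongrightarrow> L) (at 0)"
    unfolding q_def L_def by (rule has_dir_deriv_pairing_tendsto[OF L2 w])
  have "((\<lambda>h. q (- h)) \<longlongrightarrow> L) (at 0)"
    using lim filterlim_filtermap[of q "nhds L" uminus "at 0"] by (simp add: filtermap_at_minus)
  then have "(q \<longlongrightarrow> - L) (at 0)"
    unfolding odd by (simp add: tendsto_minus_cancel_left)
  with lim have "L = - L"
    by (rule LIM_unique)
  then show "(\<integral>\<omega>. w x \<omega> * v x \<omega> \<partial>M) = 0"
    by (simp add: L_def)
qed

end
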